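(* There exist two disjointly frequently hypercyclic weighted shifts on $\ell^1(\mathbb N)$; that is, there exist bounded weight sequences $w$ and $w'$ such that the weighted backward shifts $B_w$ and $B_{w'}$ on $\ell^1(\mathbb N)$ are disjointly frequently hypercyclic.
   Context: For a bounded sequence $w=(w_n)_{n\geq1}$ of nonzero scalars, the weighted (backward) shift $B_w$ on $\ell^1(\mathbb N)$, with canonical basis $(e_j)_{j\geq0}$, is the bounded operator $B_w\left(\sum_{j\ge0}x_je_j\right)=\sum_{j\geq0}w_{j+1}x_{j+1}e_j$. Continuous linear operators $T_1,\dots,T_N$ on a separable infinite-dimensional $F$-space $X$ are disjointly frequently hypercyclic if there is $x\in X$ such that, for any nonempty open set $U\subset X^N$, the set $\{n\in\mathbb N:\ (T_1^n x,\dots,T_N^n x)\in U\}$ has positive lower density, where the lower density of $A\subset\mathbb N$ is $\liminf_{n\to\infty}\frac1n\#(A\cap[1,n])$. *)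

theory Defs
  imports "HOL-Analysis.Analysis"
begin

section \<open>The Banach space $\ell^1$ over the natural numbers\<close>

typedef (overloaded) ('k::real_normed_vector) ell1 =
    "{x :: nat \<Rightarrow> 'k. summable (\<lambda>n. norm (x n))}"
  morphisms coord Abs_ell1
  by (rule exI[of _ "\<lambda>_. 0"]) simp

setup_lifting type_definition_ell1

lemma summable_norm_coord [simp]: "summable (\<lambda>n. norm (coord x n))"
  using coord[of x] by simp

lemma ell1_eqI: "(\<And>n. coord x n = coord y n) \<Longrightarrow> x = y"
  by (metis coord_inject ext)

lemma summable_norm_add:
  fixes x y :: "nat \<Rightarrow> 'a::real_normed_vector"
  assumes "summable (\<lambda>n. norm (x n))" "summable (\<lambda>n. norm (y n))"
  shows "summable (\<lambda>n. norm (x n + y n))"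
  by (rule summable_comparison_test'[OF summable_add[OF assms], where N = 0])
     (simp add: norm_triangle_ineq)

instantiation ell1 :: (real_normed_vector) real_vector
begin

lift_definition zero_ell1 :: "'a ell1" is "\<lambda>_. 0" by simp

lift_definition uminus_ell1 :: "'a ell1 \<Rightarrow> 'a ell1" is "\<lambda>x n. - x n" by simp

lift_definition plus_ell1 :: "'a ell1 \<Rightarrow> 'a ell1 \<Rightarrow> 'a ell1" is "\<lambda>x y n. x n + y n"
  by (rule summable_norm_add)

lift_definition minus_ell1 :: "'a ell1 \<Rightarrow> 'a ell1 \<Rightarrow> 'a ell1" is "\<lambda>x y n. x n - y n"
  subgoal for x y using summable_norm_add[of x "\<lambda>n. - y n"] by simp
  done

lift_definition scaleR_ell1 :: "real \<Rightarrow> 'a ell1 \<Rightarrow> 'a ell1" is "\<lambda>c x n. c *\<^sub>R x n"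
  by (simp add: summable_mult)

instance
  by standard (transfer; simp add: algebra_simps fun_eq_iff)+

end

instantiation ell1 :: (real_normed_vector) real_normed_vector
begin

lift_definition norm_ell1 :: "'a ell1 \<Rightarrow> real" is "\<lambda>x. \<Sum>n. norm (x n)" .

definition dist_ell1 :: "'a ell1 \<Rightarrow> 'a ell1 \<Rightarrow> real"
  where "dist_ell1 x y = norm (x - y)"

definition sgn_ell1 :: "'a ell1 \<Rightarrow> 'a ell1"
  where "sgn_ell1 x = x /\<^sub>R norm x"

definition uniformity_ell1 :: "('a ell1 \<times> 'a ell1) filter"
  where "uniformity_ell1 = (INF e\<in>{0<..}. principal {(x, y). dist x y < e})"

definition open_ell1 :: "'a ell1 set \<Rightarrow> bool"
  where "open_ell1 U \<longleftrightarrow> (\<forall>x\<in>U. \<forall>\<^sub>F (x', y) in uniformity. x' = x \<longrightarrow> y \<in> U)"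

instance
proof
  fix x y :: "'a ell1" and c :: real
  show "(norm x = 0) = (x = 0)"
    by transfer (auto simp: suminf_eq_zero_iff fun_eq_iff)
  show "norm (x + y) \<le> norm x + norm y"
  proof transfer
    fix x y :: "nat \<Rightarrow> 'a"
    assume s: "summable (\<lambda>n. norm (x n))" "summable (\<lambda>n. norm (y n))"
    have "summable (\<lambda>n. norm (x n + y n))"
      by (rule summable_norm_add[OF s])
    then have "(\<Sum>n. norm (x n + y n)) \<le> (\<Sum>n. norm (x n) + norm (y n))"
      by (intro suminf_le summable_add s norm_triangle_ineq)
    also have "\<dots> = (\<Sum>n. norm (x n)) + (\<Sum>n. norm (y n))"
      by (simp add: suminf_add s)
    finally show "(\<Sum>n. norm (x n + y n)) \<le> (\<Sum>n. norm (x n)) + (\<Sum>n. norm (y n))" .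
  qed
  show "norm (c *\<^sub>R x) = \<bar>c\<bar> * norm x"
    by transfer (simp add: suminf_mult)
qed (simp_all add: dist_ell1_def sgn_ell1_def uniformity_ell1_def open_ell1_def)

end

lemmas norm_ell1_eq = norm_ell1.rep_eq

lemma sum_norm_coord_le: "(\<Sum>i<n. norm (coord x i)) \<le> norm x"
  unfolding norm_ell1_eq by (rule sum_le_suminf) auto

lemma norm_coord_le: "norm (coord x i) \<le> norm x"
proof -
  have "norm (coord x i) \<le> (\<Sum>j<Suc i. norm (coord x j))"
    by (simp add: sum_nonneg)
  then show ?thesis
    using sum_norm_coord_le[of x "Suc i"] by linarith
qed

instance ell1 :: (banach) banach
proof
  fix X :: "nat \<Rightarrow> 'a ell1"
  assume C: "Cauchy X"
  have "\<exists>l. (\<lambda>n. coord (X n) i) \<longlonglongrightarrow> l" for i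
  proof -
    have "Cauchy (\<lambda>n. coord (X n) i)"
    proof (rule CauchyI)
      fix e :: real
      assume "0 < e"
      then obtain M where M: "\<forall>m\<ge>M. \<forall>n\<ge>M. norm (X m - X n) < e"
        using CauchyD[OF C] by blast
      have "norm (coord (X m) i - coord (X n) i) \<le> norm (X m - X n)" for m n
        using norm_coord_le[of "X m - X n" i] by (simp add: minus_ell1.rep_eq)
      then show "\<exists>M. \<forall>m\<ge>M. \<forall>n\<ge>M. norm (coord (X m) i - coord (X n) i) < e"
        using M le_less_trans by blast
    qed
    then show ?thesis
      using Cauchy_convergent_iff convergent_def by blast
  qed
  then obtain l where l: "\<And>i. (\<lambda>n. coord (X n) i) \<longlonglongrightarrow> l i"
    by metis
  have partial: "(\<Sum>i<k. norm (coord (X m) i - l i)) \<le> e"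
    if M: "\<forall>m\<ge>M. \<forall>n\<ge>M. norm (X m - X n) < e" and "m \<ge> M" for M m e k
  proof (rule LIMSEQ_le_const2)
    show "(\<lambda>n. \<Sum>i<k. norm (coord (X m) i - coord (X n) i))
        \<longlonglongrightarrow> (\<Sum>i<k. norm (coord (X m) i - l i))"
      by (intro tendsto_sum tendsto_norm tendsto_diff tendsto_const l)
    have "(\<Sum>i<k. norm (coord (X m) i - coord (X n) i)) \<le> e" if "n \<ge> M" for n
      using sum_norm_coord_le[of "X m - X n" k] M \<open>m \<ge> M\<close> that
      by (force simp: minus_ell1.rep_eq)
    then show "\<exists>N. \<forall>n\<ge>N. (\<Sum>i<k. norm (coord (X m) i - coord (X n) i)) \<le> e"
      by blast
  qed
  have summ: "summable (\<lambda>i. norm (coord (X m) i - l i))"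
    if "\<forall>m\<ge>M. \<forall>n\<ge>M. norm (X m - X n) < e" "m \<ge> M" for M m e
    by (rule summableI_nonneg_bounded[where x = e]) (use partial[OF that] in auto)
  obtain M1 where M1: "\<forall>m\<ge>M1. \<forall>n\<ge>M1. norm (X m - X n) < 1"
    using CauchyD[OF C, of 1] by auto
  have "summable (\<lambda>i. norm (l i))"
  proof (rule summable_comparison_test'[where N = 0])
    show "summable (\<lambda>i. norm (coord (X M1) i - l i) + norm (coord (X M1) i))"
      by (intro summable_add summ[OF M1] summable_norm_coord) auto
    show "norm (norm (l i)) \<le> norm (coord (X M1) i - l i) + norm (coord (X M1) i)" for i
      using norm_triangle_ineq4[of "coord (X M1) i" "coord (X M1) i - l i"] by simp
  qed
  then have coordL: "coord (Abs_ell1 l) = l"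
    by (simp add: Abs_ell1_inverse)
  have "X \<longlonglongrightarrow> Abs_ell1 l"
  proof (rule LIMSEQ_I)
    fix r :: real
    assume "0 < r"
    then obtain M where M: "\<forall>m\<ge>M. \<forall>n\<ge>M. norm (X m - X n) < r / 2"
      using CauchyD[OF C, of "r / 2"] by auto
    have "norm (X m - Abs_ell1 l) \<le> r / 2" if "m \<ge> M" for m
      unfolding norm_ell1_eq minus_ell1.rep_eq coordL
      by (rule suminf_le_const[OF summ[OF M that] partial[OF M that]])
    then show "\<exists>M. \<forall>m\<ge>M. norm (X m - Abs_ell1 l) < r"
      using \<open>0 < r\<close> by (intro exI[of _ M]) force
  qed
  then show "convergent X"
    by (rule convergentI)
qed


section \<open>Weighted backward shifts\<close>

text \<open>Weights are indexed from 1; the value \<open>w 0\<close> is never used.\<close>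

definition weight_sequence :: "(nat \<Rightarrow> 'k::real_normed_field) \<Rightarrow> bool"
  where "weight_sequence w \<longleftrightarrow> bounded (w ` {1..}) \<and> (\<forall>n\<ge>1. w n \<noteq> 0)"

text \<open>
  The sequence under \<open>Abs_ell1\<close> is summable when \<open>w\<close> is a weight sequence
  (see \<open>coord_weighted_shift\<close>); otherwise the value may be unspecified.
\<close>

definition weighted_shift :: "(nat \<Rightarrow> 'k::real_normed_field) \<Rightarrow> 'k ell1 \<Rightarrow> 'k ell1"
  where "weighted_shift w x = Abs_ell1 (\<lambda>j. w (j + 1) * coord x (j + 1))"

lemma weighted_shift_summable:
  fixes w :: "nat \<Rightarrow> 'k::real_normed_field"
  assumes "\<And>n. n \<ge> 1 \<Longrightarrow> norm (w n) \<le> C"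
  shows "summable (\<lambda>j. norm (w (j + 1) * coord x (j + 1)))"
proof (rule summable_comparison_test'[where N = 0])
  show "summable (\<lambda>j. C * norm (coord x (j + 1)))"
    by (intro summable_mult summable_ignore_initial_segment summable_norm_coord)
  show "norm (norm (w (j + 1) * coord x (j + 1))) \<le> C * norm (coord x (j + 1))" for j
    using assms[of "j + 1"] by (simp add: norm_mult mult_right_mono)
qed

lemma coord_weighted_shift:
  assumes "weight_sequence w"
  shows "coord (weighted_shift w x) j = w (j + 1) * coord x (j + 1)"
proof -
  obtain C where "\<And>n. n \<ge> 1 \<Longrightarrow> norm (w n) \<le> C"
    using assms unfolding weight_sequence_def bounded_iff by auto
  then show ?thesis
    using weighted_shift_summable[of w C x] by (simp add: weighted_shift_def Abs_ell1_inverse)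
qed

lemma bounded_linear_weighted_shift:
  assumes w: "weight_sequence w"
  shows "bounded_linear (weighted_shift w)"
proof -
  obtain C where C: "\<And>n. n \<ge> 1 \<Longrightarrow> norm (w n) \<le> C"
    using w unfolding weight_sequence_def bounded_iff by auto
  show ?thesis
  proof (rule bounded_linear_intro[where K = C])
    fix x y and r :: real
    show "weighted_shift w (x + y) = weighted_shift w x + weighted_shift w y"
      by (rule ell1_eqI) (simp add: coord_weighted_shift[OF w] plus_ell1.rep_eq algebra_simps)
    show "weighted_shift w (r *\<^sub>R x) = r *\<^sub>R weighted_shift w x"
      by (rule ell1_eqI) (simp add: coord_weighted_shift[OF w] scaleR_ell1.rep_eq)
    have C0: "0 \<le> C"
      using C[of 1] norm_ge_zero[of "w 1"] by linarith
    have s: "summable (\<lambda>j. norm (coord x (j + 1)))"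
      by (rule summable_ignore_initial_segment) simp
    have "norm (weighted_shift w x) = (\<Sum>j. norm (w (j + 1) * coord x (j + 1)))"
      by (simp add: norm_ell1_eq coord_weighted_shift[OF w])
    also have "\<dots> \<le> (\<Sum>j. C * norm (coord x (j + 1)))"
    proof (rule suminf_le)
      show "norm (w (j + 1) * coord x (j + 1)) \<le> C * norm (coord x (j + 1))" for j
        using C[of "j + 1"] by (simp add: norm_mult mult_right_mono)
    qed (use weighted_shift_summable[of w C x] C s in \<open>auto intro: summable_mult\<close>)
    also have "\<dots> = C * (\<Sum>j. norm (coord x (j + 1)))"
      by (rule suminf_mult[OF s])
    also have "\<dots> \<le> C * norm x"
      using suminf_split_initial_segment[of "\<lambda>j. norm (coord x j)" 1] C0
      by (intro mult_left_mono) (auto simp: norm_ell1_eq)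
    finally show "norm (weighted_shift w x) \<le> norm x * C"
      by (simp add: mult.commute)
  qed
qed


section \<open>Disjoint frequent hypercyclicity\<close>

definition lower_density :: "nat set \<Rightarrow> ereal"
  where "lower_density A = liminf (\<lambda>n. ereal (real (card (A \<inter> {1..n})) / real n))"

text \<open>
  The operators \<open>T i\<close> are indexed by a finite type \<open>'n\<close>, and \<open>'a ^ 'n\<close> carries the product
  topology. Linearity is stated over the reals, also when \<open>'a\<close> is a complex space.
\<close>

definition disjointly_frequently_hypercyclic ::
    "('n::finite \<Rightarrow> 'a::{real_vector, topological_space} \<Rightarrow> 'a) \<Rightarrow> bool"
  where "disjointly_frequently_hypercyclic T \<longleftrightarrow>
    (\<forall>i. linear (T i) \<and> continuous_on UNIV (T i)) \<and>
    (\<exists>x. \<forall>U :: ('a ^ 'n) set. open U \<and> U \<noteq> {} \<longrightarrow>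
      lower_density {n. (\<chi> i. (T i ^^ n) x) \<in> U} > 0)"

end

theory Submission
  imports Defs
begin

text \<open>
  Write \<open>W k = w 1 \<cdots> w k\<close>, so that \<open>coord (B_w^n x) k = W (n + k) / W k * x (n + k)\<close>. Take a
  sequence of pairs of finite nonzero words \<open>(a p, b p)\<close> of length \<open>d p\<close> that is dense for every
  length, and disjoint sets \<open>E p\<close> of positive lower density whose points are separated by gaps as
  large as we like in terms of \<open>p\<close>. A single vector \<open>x\<close>, supported on the intervals
  \<open>[n, n + d p)\<close> with \<open>n \<in> E p\<close> and not depending on the words themselves, works for both shifts:
  on such an interval \<open>W\<close> is forced by \<open>W (n + i) * x (n + i) = a p i\<close>, and \<open>W'\<close> by the same
  equation with \<open>b\<close>. This makes the weights very small at some places, but they stay bounded, and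
  long gaps let \<open>W k\<close> return to \<open>8^k\<close> and stay above \<open>4^k\<close> throughout. For \<open>n \<in> E p\<close> the vector
  \<open>B_w^n x\<close> is then close to the one with coordinates \<open>a p k / W k\<close> for \<open>k < d p\<close>. Since the words
  are dense, so are these pairs of targets, although \<open>W\<close> and \<open>W'\<close> depend on the words.
\<close>

section \<open>Separated sets of positive lower density\<close>

lemma lower_density_pos:
  assumes "0 < c" and "\<And>n. n \<ge> n\<^sub>0 \<Longrightarrow> c * real n \<le> real (card (A \<inter> {1..n}))"
  shows "lower_density A > 0"
proof -
  have "ereal c \<le> liminf (\<lambda>n. ereal (real (card (A \<inter> {1..n})) / real n))"
  proof (rule Liminf_bounded)
    show "\<forall>\<^sub>F n in sequentially. ereal c \<le> ereal (real (card (A \<inter> {1..n})) / real n)"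
      using eventually_ge_at_top[of "max n\<^sub>0 1"]
    proof eventually_elim
      case (elim n)
      then show ?case
        using assms(2)[of n] by (simp add: field_simps)
    qed
  qed
  then show ?thesis
    using assms(1) unfolding lower_density_def by (meson ereal_less(2) order_less_le_trans)
qed

lemma lower_density_mono:
  assumes "A \<subseteq> B"
  shows "lower_density A \<le> lower_density B"
  unfolding lower_density_def
  by (intro Liminf_mono always_eventually allI)
     (use assms in \<open>auto intro!: divide_right_mono card_mono\<close>)

text \<open>Uniqueness of the 2-adic valuation: with \<open>a < b\<close>, cancelling
  \<open>2 ^ a\<close> would leave an odd number equal to an even one.\<close>

lemma power2_odd_inj:
  fixes i j :: nat
  assumes "2 ^ a * (2 * i + 1) = (2::nat) ^ b * (2 * j + 1)"
  shows "a = b"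
proof -
  have *: "\<not> a < b" if "2 ^ a * (2 * i + 1) = (2::nat) ^ b * (2 * j + 1)" for a b i j :: nat
  proof
    assume "a < b"
    then obtain k where "b = a + Suc k"
      by (metis less_imp_Suc_add add_Suc_right)
    with that have "2 ^ a * (2 * i + 1) = 2 ^ a * (2 * (2 ^ k * (2 * j + 1)))"
      by (simp add: power_add mult_ac)
    then have "2 * i + 1 = 2 * (2 ^ k * (2 * j + 1))"
      by (subst (asm) mult_cancel_left) simp
    then show False by presburger
  qed
  show ?thesis
    using *[OF assms] *[OF assms[symmetric]] by simp
qed

text \<open>Integers of 2-adic valuation exactly \<open>t p\<close> form disjoint sets with bounded
  gaps. An increasing map that inserts the required room around each of them, yet grows at most
  linearly, keeps their lower densities positive.\<close>

lemma separated_sets: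
  fixes N :: "nat \<Rightarrow> nat"
  assumes N: "\<And>p. 0 < N p"
  obtains E :: "nat \<Rightarrow> nat set" where
    "\<And>p. lower_density (E p) > 0"
    "\<And>p n. n \<in> E p \<Longrightarrow> N p \<le> n"
    "\<And>p q n. n \<in> E p \<Longrightarrow> n \<in> E q \<Longrightarrow> p = q"
    "\<And>p q n m. n \<in> E p \<Longrightarrow> m \<in> E q \<Longrightarrow> n < m \<Longrightarrow> n + N p + N q \<le> m"
proof -
  \<comment> \<open>Strict growth makes the valuation \<open>t p\<close> determine \<open>p\<close>;
    the bound \<open>p + N p \<le> t p\<close> makes the quotients \<open>N p / 2 ^ t p\<close>
    summable.\<close>
  define t where "t p = (\<Sum>q\<le>p. N q + 1)" for p
  have t_mono: "strict_mono t"
    by (rule strict_mono_Suc_iff[THEN iffD2]) (simp add: t_def)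
  have tp: "p + N p \<le> t p" for p
  proof -
    have "(\<Sum>q<p. 1) \<le> (\<Sum>q<p. N q + 1)" by (rule sum_mono) simp
    then show ?thesis
      by (simp add: t_def lessThan_Suc_atMost[symmetric])
  qed
  \<comment> \<open>The first summand of \<open>\<phi>\<close> jumps by \<open>N p\<close> when a multiple of \<open>2 ^ t p\<close> is reached and the
    second one when it is left. The set \<open>E p\<close> is the image of the odd multiples of \<open>2 ^ t p\<close>;
    since \<open>N p \<le> 2 ^ (t p - p)\<close>, the function \<open>\<phi>\<close> grows at most linearly.\<close>
  define \<phi> where
    "\<phi> l = (\<Sum>p<l. N p * (l div 2 ^ t p) + N p * ((l - 1) div 2 ^ t p))" for l :: nat
  \<comment> \<open>Terms with \<open>l \<le> p\<close> vanish, so the sum may be extended to any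
    common range; this allows termwise comparison of two values of \<open>\<phi>\<close>.\<close>
  have big: "l div 2 ^ t p = 0" if "l \<le> p" for l p
  proof -
    have "l < 2 ^ l" by simp
    also have "(2::nat) ^ l \<le> 2 ^ t p"
      using that tp[of p] by (intro power_increasing) auto
    finally show ?thesis by simp
  qed
  have \<phi>_eq: "\<phi> l = (\<Sum>p<M. N p * (l div 2 ^ t p) + N p * ((l - 1) div 2 ^ t p))"
    if "l \<le> M" for l M
    unfolding \<phi>_def
    by (rule sum.mono_neutral_left) (use that in \<open>auto simp: big\<close>)
  have \<phi>_le: "\<phi> l \<le> 4 * l" for l
  proof -
    have "real (\<phi> l) \<le> (\<Sum>p<l. 2 * real l * (1/2) ^ p)"
      unfolding \<phi>_def of_nat_sum
    proof (rule sum_mono)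
      fix p
      have "real (N p) * 2 ^ p \<le> 2 ^ t p"
      proof -
        have "real (N p) \<le> 2 ^ N p" by (rule less_imp_le) (simp add: of_nat_less_two_power)
        then have "real (N p) * 2 ^ p \<le> 2 ^ (N p + p)"
          by (simp add: power_add)
        also have "\<dots> \<le> 2 ^ t p"
          using tp[of p] by (intro power_increasing) auto
        finally show ?thesis .
      qed
      then have Nt: "real (N p) / 2 ^ t p \<le> (1/2) ^ p"
        by (simp add: field_simps)
      have d: "real (N p) * real (x div 2 ^ t p) \<le> real l * (1/2) ^ p" if "x \<le> l" for x
      proof -
        have "real (x div 2 ^ t p * 2 ^ t p) \<le> real x"
          by (rule of_nat_mono) (rule div_times_less_eq_dividend)
        then have "real (x div 2 ^ t p) \<le> real x / 2 ^ t p"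
          by (simp add: pos_le_divide_eq)
        also have "\<dots> \<le> real l / 2 ^ t p"
          using that by (simp add: divide_right_mono)
        finally have "real (N p) * real (x div 2 ^ t p) \<le> real (N p) * (real l / 2 ^ t p)"
          by (rule mult_left_mono) simp
        also have "\<dots> = real l * (real (N p) / 2 ^ t p)" by simp
        also have "\<dots> \<le> real l * (1/2) ^ p"
          by (rule mult_left_mono[OF Nt]) simp
        finally show ?thesis .
      qed
      show "real (N p * (l div 2 ^ t p) + N p * ((l - 1) div 2 ^ t p)) \<le> 2 * real l * (1/2) ^ p"
        using d[of l] d[of "l - 1"] by simp
    qed
    also have "\<dots> = 2 * real l * (\<Sum>p<l. (1/2) ^ p)"
      by (simp add: sum_distrib_left)
    also have "(\<Sum>p<l. (1/2::real) ^ p) \<le> 2"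
      by (simp add: sum_gp_strict)
    then have "2 * real l * (\<Sum>p<l. (1/2) ^ p) \<le> 2 * real l * 2"
      by (rule mult_left_mono) simp
    finally show ?thesis by linarith
  qed
  define L where "L p = range (\<lambda>i::nat. 2 ^ t p * (2 * i + 1))" for p
  have \<phi>_gap: "\<phi> l + N p + N q \<le> \<phi> m" if "l \<in> L p" "m \<in> L q" "l < m" for l m p q
  proof -
    obtain i where i: "l = 2 ^ t p * (2 * i + 1)" using \<open>l \<in> L p\<close> by (auto simp: L_def)
    obtain j where j: "m = 2 ^ t q * (2 * j + 1)" using \<open>m \<in> L q\<close> by (auto simp: L_def)
    \<comment> \<open>The range covers both arguments and also contains the indices \<open>p\<close>
      and \<open>q\<close>, whose terms supply the two gaps.\<close>
    define M where "M = Suc (m + p + q)"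
    have A: "(l - 1) div 2 ^ t p + 1 \<le> (m - 1) div 2 ^ t p"
    proof -
      have "(l - 1) div 2 ^ t p < 2 * i + 1"
        by (rule less_mult_imp_div_less) (simp add: i mult.commute)
      also have "2 * i + 1 = l div 2 ^ t p" by (simp add: i)
      also have "\<dots> \<le> (m - 1) div 2 ^ t p"
        using \<open>l < m\<close> by (intro div_le_mono) simp
      finally show ?thesis by simp
    qed
    have B: "l div 2 ^ t q + 1 \<le> m div 2 ^ t q"
    proof -
      have "l div 2 ^ t q < 2 * j + 1"
        by (rule less_mult_imp_div_less) (use \<open>l < m\<close> j in \<open>simp add: mult.commute\<close>)
      also have "2 * j + 1 = m div 2 ^ t q" by (simp add: j)
      finally show ?thesis by simp
    qed
    have "(\<Sum>r<M. N r * ((l - 1) div 2 ^ t r)) + N p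
        = (\<Sum>r<M. N r * ((l - 1) div 2 ^ t r) + (if r = p then N p else 0))"
      by (simp add: sum.distrib M_def)
    also have "\<dots> \<le> (\<Sum>r<M. N r * ((m - 1) div 2 ^ t r))"
    proof (rule sum_mono)
      fix r
      have "N r * ((l - 1) div 2 ^ t r) \<le> N r * ((m - 1) div 2 ^ t r)"
        using \<open>l < m\<close> by (intro mult_left_mono div_le_mono) auto
      moreover have "N p * ((l - 1) div 2 ^ t p + 1) \<le> N p * ((m - 1) div 2 ^ t p)"
        using A by (intro mult_left_mono) auto
      ultimately show "N r * ((l - 1) div 2 ^ t r) + (if r = p then N p else 0)
          \<le> N r * ((m - 1) div 2 ^ t r)"
        by (auto simp: distrib_left)
    qed
    finally have 1: "(\<Sum>r<M. N r * ((l - 1) div 2 ^ t r)) + N p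
        \<le> (\<Sum>r<M. N r * ((m - 1) div 2 ^ t r))" .
    have "(\<Sum>r<M. N r * (l div 2 ^ t r)) + N q
        = (\<Sum>r<M. N r * (l div 2 ^ t r) + (if r = q then N q else 0))"
      by (simp add: sum.distrib M_def)
    also have "\<dots> \<le> (\<Sum>r<M. N r * (m div 2 ^ t r))"
    proof (rule sum_mono)
      fix r
      have "N r * (l div 2 ^ t r) \<le> N r * (m div 2 ^ t r)"
        using \<open>l < m\<close> by (intro mult_left_mono div_le_mono) auto
      moreover have "N q * (l div 2 ^ t q + 1) \<le> N q * (m div 2 ^ t q)"
        using B by (intro mult_left_mono) auto
      ultimately show "N r * (l div 2 ^ t r) + (if r = q then N q else 0)
          \<le> N r * (m div 2 ^ t r)"
        by (auto simp: distrib_left)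
    qed
    finally have 2: "(\<Sum>r<M. N r * (l div 2 ^ t r)) + N q \<le> (\<Sum>r<M. N r * (m div 2 ^ t r))" .
    have "\<phi> l = (\<Sum>r<M. N r * (l div 2 ^ t r)) + (\<Sum>r<M. N r * ((l - 1) div 2 ^ t r))"
      using \<open>l < m\<close> by (subst \<phi>_eq[of l M]) (auto simp: M_def sum.distrib)
    moreover have "\<phi> m = (\<Sum>r<M. N r * (m div 2 ^ t r)) + (\<Sum>r<M. N r * ((m - 1) div 2 ^ t r))"
      by (subst \<phi>_eq[of m M]) (auto simp: M_def sum.distrib)
    ultimately show ?thesis using 1 2 by linarith
  qed
  have L_disj: "p = q" if "l \<in> L p" "l \<in> L q" for l p q
  proof -
    have "t p = t q" using that power2_odd_inj unfolding L_def by blast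
    then show ?thesis using t_mono by (simp add: strict_mono_eq)
  qed
  have \<phi>_less: "\<phi> l < \<phi> m" if "l \<in> L p" "m \<in> L q" "l < m" for l m p q
    using \<phi>_gap[OF that] N[of p] by linarith
  have \<phi>_ge: "N p \<le> \<phi> l" if l: "l \<in> L p" for l p
  proof -
    obtain i where i: "l = 2 ^ t p * (2 * i + 1)" using l by (auto simp: L_def)
    have "N p \<le> N p * (l div 2 ^ t p)" by (simp add: i)
    also have "\<dots> \<le> N p * (l div 2 ^ t p) + N p * ((l - 1) div 2 ^ t p)" by simp
    also have "\<dots> \<le> (\<Sum>r<Suc (l + p). N r * (l div 2 ^ t r) + N r * ((l - 1) div 2 ^ t r))"
      by (rule member_le_sum) auto
    also have "\<dots> = \<phi> l" by (rule \<phi>_eq[symmetric]) simp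
    finally show ?thesis .
  qed
  show ?thesis
  proof (rule that[of "\<lambda>p. \<phi> ` L p"])
    show "N p \<le> n" if "n \<in> \<phi> ` L p" for p n
      using that \<phi>_ge by auto
    show "p = q" if "n \<in> \<phi> ` L p" "n \<in> \<phi> ` L q" for p q n
      using that \<phi>_less L_disj by (metis imageE less_irrefl linorder_neqE_nat)
    show "n + N p + N q \<le> m" if "n \<in> \<phi> ` L p" "m \<in> \<phi> ` L q" "n < m" for p q n m
    proof -
      obtain l l' where l: "l \<in> L p" "n = \<phi> l" "l' \<in> L q" "m = \<phi> l'"
        using \<open>n \<in> \<phi> ` L p\<close> \<open>m \<in> \<phi> ` L q\<close> by blast
      have "l < l'"
        using \<phi>_less[OF l(3,1)] l \<open>n < m\<close> by (metis less_asym linorder_neqE_nat)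
      then show ?thesis using \<phi>_gap l by blast
    qed
    show "lower_density (\<phi> ` L p) > 0" for p
    proof (rule lower_density_pos[where n\<^sub>0 = "32 * 2 ^ t p"])
      show "0 < 1 / (2 * real (8 * 2 ^ t p))" by simp
      fix n :: nat assume n: "32 * 2 ^ t p \<le> n"
      \<comment> \<open>By \<open>\<phi>_le\<close>, the \<open>i\<close>-th element is at most
        \<open>4 * 2 ^ t p * (2 * i + 1)\<close>, hence at most \<open>c * (i + 1)\<close>, so
        \<open>{1..n}\<close> contains the first \<open>n div c\<close> elements. Rounding down
        loses at most a factor 2 once \<open>c \<le> n\<close>.\<close>
      define c :: nat where "c = 8 * 2 ^ t p"
      define e where "e i = \<phi> (2 ^ t p * (2 * i + 1))" for i
      have mem: "2 ^ t p * (2 * i + 1) \<in> L p" for i by (auto simp: L_def)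
      have "inj e"
      proof (rule linorder_injI)
        fix i j :: nat assume "i < j"
        then have "e i < e j" unfolding e_def by (intro \<phi>_less[OF mem mem]) simp
        then show "e i \<noteq> e j" by simp
      qed
      have "e ` {..<n div c} \<subseteq> \<phi> ` L p \<inter> {1..n}"
      proof (intro image_subsetI IntI)
        fix i assume i: "i \<in> {..<n div c}"
        show "e i \<in> \<phi> ` L p" unfolding e_def using mem by blast
        have "4 * (2 ^ t p * (2 * i + 1)) \<le> c * Suc i" by (simp add: c_def)
        also have "\<dots> \<le> c * (n div c)" using i by (intro mult_left_mono) auto
        also have "\<dots> \<le> n" by simp
        finally have "e i \<le> n" unfolding e_def using \<phi>_le order_trans by blast
        moreover have "1 \<le> e i"
          unfolding e_def using \<phi>_ge[OF mem, of i] N[of p] by simp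
        ultimately show "e i \<in> {1..n}" by simp
      qed
      then have "card (e ` {..<n div c}) \<le> card (\<phi> ` L p \<inter> {1..n})"
        by (intro card_mono) auto
      then have "n div c \<le> card (\<phi> ` L p \<inter> {1..n})"
        using \<open>inj e\<close> by (simp add: card_image inj_on_subset[of e UNIV])
      moreover have "n \<le> 2 * c * (n div c)"
      proof -
        have "n mod c < c" by (simp add: c_def)
        moreover have "c * 1 \<le> c * (n div c)"
          using n by (intro mult_left_mono) (auto simp: c_def div_greater_zero_iff Suc_le_eq)
        moreover have "n = c * (n div c) + n mod c" by simp
        ultimately show ?thesis by linarith
      qed
      then have "real n \<le> 2 * real c * real (n div c)"
        by (metis of_nat_le_iff of_nat_mult of_nat_numeral)
      then have "1 / (2 * real c) * real n \<le> real (n div c)"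
        by (simp add: c_def field_simps)
      ultimately show "1 / (2 * real (8 * 2 ^ t p)) * real n
          \<le> real (card (\<phi> ` L p \<inter> {1..n}))"
        unfolding c_def[symmetric] by linarith
    qed
  qed
qed

section \<open>Weights prescribed on blocks\<close>

text \<open>Finite words over a countable dense set of pairs of nonzero scalars are countably many.
  The tolerances vary with the position and are chosen after the enumeration, so they may later
  contain products of weights built from these very words.\<close>

lemma dense_enumeration:
  obtains d :: "nat \<Rightarrow> nat" and a b :: "nat \<Rightarrow> nat \<Rightarrow> 'k::{real_normed_field, euclidean_space}"
  where
    "\<And>p j. j < d p \<Longrightarrow> a p j \<noteq> 0 \<and> b p j \<noteq> 0"
    "\<And>m \<alpha> \<beta> \<eta> \<eta>'. (\<And>j. 0 < \<eta> j \<and> 0 < \<eta>' j) \<Longrightarrow>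
      \<exists>p. d p = m \<and> (\<forall>j<m. norm (a p j - \<alpha> j) < \<eta> j \<and> norm (b p j - \<beta> j) < \<eta>' j)"
proof -
  obtain D :: "'k set" where D: "countable D" "\<And>X. open X \<Longrightarrow> X \<noteq> {} \<Longrightarrow> \<exists>d\<in>D. d \<in> X"
    using countable_dense_exists by blast
  have near: "\<exists>q\<in>D - {0}. norm (q - z) < e" if "0 < e" for z e
  proof -
    \<comment> \<open>Removing 0 cannot exhaust a ball, since a singleton is not open here.\<close>
    have "ball z e - {0} \<noteq> {}"
    proof
      assume "ball z e - {0} = {}"
      moreover have "z \<in> ball z e" using that by simp
      ultimately have "ball z e = {0}" by blast
      then show False by (metis open_ball not_open_singleton)
    qed
    moreover have "open (ball z e - {0})" by (simp add: open_delete)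
    ultimately show ?thesis
      using D(2) by (fastforce simp: dist_norm norm_minus_commute)
  qed
  define P where "P = lists ((D - {0}) \<times> (D - {0}))"
  define l where "l = from_nat_into P"
  have P: "countable P" "P \<noteq> {}"
    unfolding P_def using D(1) by (auto intro: countable_lists)
  have l: "range l = P" unfolding l_def using P by (intro range_from_nat_into)
  show ?thesis
  proof (rule that[of "\<lambda>p. length (l p)" "\<lambda>p j. fst (l p ! j)" "\<lambda>p j. snd (l p ! j)"])
    fix p j assume "j < length (l p)"
    moreover have "l p \<in> P" using l by blast
    ultimately have "l p ! j \<in> (D - {0}) \<times> (D - {0})"
      unfolding P_def by (auto simp: in_lists_conv_set)
    then show "fst (l p ! j) \<noteq> 0 \<and> snd (l p ! j) \<noteq> 0" by auto
  next
    fix m :: nat and \<alpha> \<beta> :: "nat \<Rightarrow> 'k" and \<eta> \<eta>' :: "nat \<Rightarrow> real"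
    assume pos: "\<And>j. 0 < \<eta> j \<and> 0 < \<eta>' j"
    have "\<forall>j. \<exists>q\<in>D - {0}. norm (q - \<alpha> j) < \<eta> j" using near pos by blast
    then obtain u where u: "\<And>j. u j \<in> D - {0} \<and> norm (u j - \<alpha> j) < \<eta> j" by metis
    have "\<forall>j. \<exists>q\<in>D - {0}. norm (q - \<beta> j) < \<eta>' j" using near pos by blast
    then obtain v where v: "\<And>j. v j \<in> D - {0} \<and> norm (v j - \<beta> j) < \<eta>' j" by metis
    have "map (\<lambda>j. (u j, v j)) [0..<m] \<in> P"
      unfolding P_def using u v by auto
    then obtain p where "l p = map (\<lambda>j. (u j, v j)) [0..<m]"
      using l by (metis rangeE)
    then show "\<exists>p. length (l p) = m \<and> (\<forall>j<m. norm (fst (l p ! j) - \<alpha> j) < \<eta> j \<and>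
        norm (snd (l p ! j) - \<beta> j) < \<eta>' j)"
      using u v by (intro exI[of _ p]) auto
  qed
qed

text \<open>The words are left out, and only their lengths \<open>d p\<close> and a size exponent
  \<open>s p\<close> enter: two families of words can then share the blocks and the vector. In
  \<open>N p\<close>, the summand \<open>s p * (2 * d p + 1)\<close> is the exponent of the smallest
  value that a profile can take on a word.\<close>

locale separated_blocks =
  fixes d s N :: "nat \<Rightarrow> nat" and E :: "nat \<Rightarrow> nat set"
  assumes N_eq: "N p = Suc (d p + s p * (2 * d p + 1))"
    and E_ge: "n \<in> E p \<Longrightarrow> N p \<le> n"
    and E_disjoint: "n \<in> E p \<Longrightarrow> n \<in> E q \<Longrightarrow> p = q"
    and E_separated: "n \<in> E p \<Longrightarrow> m \<in> E q \<Longrightarrow> n < m \<Longrightarrow> n + N p + N q \<le> m"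
begin

lemma d_less_N: "d p < N p"
  by (simp add: N_eq)

text \<open>A block has length \<open>N p\<close>, not \<open>d p\<close>: the positions after the
  word are where the weight products recover.\<close>

definition in_block :: "nat \<Rightarrow> nat \<Rightarrow> nat \<Rightarrow> nat \<Rightarrow> bool"
  where "in_block k p n i \<longleftrightarrow> n \<in> E p \<and> i < N p \<and> k = n + i"

lemma in_block_unique:
  assumes "in_block k p n i" "in_block k q m j"
  shows "p = q \<and> n = m \<and> i = j"
proof -
  have "\<not> n < m" if "in_block k p n i" "in_block k q m j" for p q n m i j
    using that E_separated[of n p m q] unfolding in_block_def by auto
  from this[OF assms] this[OF assms(2,1)] have "n = m" by simp
  then show ?thesis
    using assms E_disjoint unfolding in_block_def by auto
qed

definition fill :: "'a \<Rightarrow> (nat \<Rightarrow> nat \<Rightarrow> 'a) \<Rightarrow> nat \<Rightarrow> 'a"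
  where "fill c g k = (if \<exists>p n i. in_block k p n i
    then THE v. \<exists>p n i. in_block k p n i \<and> v = g p i else c)"

lemma fill_in: "in_block k p n i \<Longrightarrow> fill c g k = g p i"
  unfolding fill_def by (auto intro!: the_equality dest: in_block_unique)

lemma fill_out: "(\<And>p n i. \<not> in_block k p n i) \<Longrightarrow> fill c g k = c"
  unfolding fill_def by auto

text \<open>
  The factor \<open>4 ^ (s p * (i + 1))\<close> makes \<open>a p i / 4 ^ (s p * (i + 1))\<close> decrease in norm with \<open>i\<close>
  as soon as all \<open>a p i\<close> have norm between \<open>2 ^ (- s p)\<close> and \<open>2 ^ s p\<close>. Hence the products of
  weights can be defined on a block by dividing by the seed, with bounded quotients.
\<close>

definition seed :: "nat \<Rightarrow> 'k::real_normed_field"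
  where "seed k = fill 0 (\<lambda>p i. if i < d p then 4 ^ (s p * (i + 1)) else 0) k / 8 ^ k"

text \<open>Inside a word the numerator is at most \<open>2 ^ N p\<close>, and blocks of
  \<open>E p\<close> start no earlier than \<open>N p\<close>, so it is at most
  \<open>2 ^ k\<close>.\<close>

lemma norm_seed: "norm (seed k :: 'k::real_normed_field) \<le> (1/4) ^ k"
proof (cases "\<exists>p n i. in_block k p n i \<and> i < d p")
  case True
  then obtain p n i where b: "in_block k p n i" "i < d p" by blast
  have "(4::real) ^ (s p * (i + 1)) = 2 ^ (2 * (s p * (i + 1)))"
    by (simp only: power_mult[of _ 2]) simp
  also have "\<dots> \<le> 2 ^ k"
  proof (rule power_increasing)
    have "2 * (s p * (i + 1)) \<le> s p * (2 * d p + 1)"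
      using b(2) mult_le_mono2[of "2 * (i + 1)" "2 * d p + 1" "s p"] by simp
    also have "\<dots> \<le> N p" by (simp add: N_eq)
    also have "\<dots> \<le> k" using b(1) E_ge unfolding in_block_def by fastforce
    finally show "2 * (s p * (i + 1)) \<le> k" .
  qed simp
  finally have *: "(4::real) ^ (s p * (i + 1)) \<le> 2 ^ k" .
  have "norm (seed k :: 'k) = 4 ^ (s p * (i + 1)) / 8 ^ k"
    using b by (simp add: seed_def fill_in norm_divide norm_power norm_mult power_add)
  also have "\<dots> \<le> 2 ^ k / 8 ^ k"
    using * by (simp add: divide_right_mono)
  also have "\<dots> = (1/4) ^ k" by (simp add: power_divide[symmetric])
  finally show ?thesis .
next
  case False
  have "fill (0::'k) (\<lambda>p i. if i < d p then 4 ^ (s p * (i + 1)) else 0) k = 0"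
  proof (cases "\<exists>p n i. in_block k p n i")
    case True
    then obtain p n i where b: "in_block k p n i" by blast
    with False have "\<not> i < d p" by blast
    then show ?thesis by (simp add: fill_in[OF b])
  qed (auto intro: fill_out)
  then show ?thesis by (simp add: seed_def)
qed

definition seed_vector :: "'k::real_normed_field ell1"
  where "seed_vector = Abs_ell1 seed"

lemma coord_seed_vector: "coord (seed_vector :: 'k::real_normed_field ell1) = seed"
proof -
  have "summable (\<lambda>k. norm (seed k :: 'k))"
    by (rule summable_comparison_test'[where N = 0, OF summable_geometric[of "1/4::real"]])
       (use norm_seed in auto)
  then show ?thesis by (simp add: seed_vector_def Abs_ell1_inverse)
qed

end

section \<open>Norm estimates and iterates of weighted shifts\<close>

lemma norm_ell1_le_geometric:
  assumes "\<And>k. norm (coord z k) \<le> c * (1/2) ^ k"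
  shows "norm z \<le> 2 * c"
proof -
  have "norm z \<le> (\<Sum>k. c * (1/2) ^ k)"
    unfolding norm_ell1_eq
    by (intro suminf_le assms summable_norm_coord summable_mult summable_geometric) simp
  also have "\<dots> = c * (\<Sum>k. (1/2) ^ k)"
    by (intro suminf_mult summable_geometric) simp
  also have "(\<Sum>k. (1/2::real) ^ k) = 2"
    by (simp add: suminf_geometric)
  finally show ?thesis by simp
qed

lemma coord_weighted_shift_funpow:
  fixes w W :: "nat \<Rightarrow> 'k::real_normed_field"
  assumes "weight_sequence w" "\<And>k. W k \<noteq> 0" "\<And>k. w (Suc k) = W (Suc k) / W k"
  shows "coord ((weighted_shift w ^^ n) x) k = W (n + k) / W k * coord x (n + k)"
proof (induction n arbitrary: k)
  case 0
  then show ?case using assms(2) by simp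
next
  case (Suc n)
  then show ?case
    using assms(2,3) by (simp add: coord_weighted_shift[OF assms(1)])
qed

section \<open>Weight products adapted to one family of words\<close>

locale block_weights = separated_blocks d s N E
  for d s N :: "nat \<Rightarrow> nat" and E :: "nat \<Rightarrow> nat set" +
  fixes a :: "nat \<Rightarrow> nat \<Rightarrow> 'k::real_normed_field"
  assumes a_upper: "i < d p \<Longrightarrow> norm (a p i) \<le> 2 ^ s p"
    and a_lower: "i < d p \<Longrightarrow> 1 / 2 ^ s p \<le> norm (a p i)"
begin

text \<open>
  The value \<open>N p\<close> is large enough for the second branch to start below the last value of the
  first one; the doubling then brings the profile back to \<open>1\<close> at the end of the block.
\<close>

definition profile :: "nat \<Rightarrow> nat \<Rightarrow> 'k"
  where "profile p i =
    (if i < d p then a p i / 4 ^ (s p * (i + 1)) else 2 ^ i / 2 ^ N p)"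

text \<open>The letter costs at most \<open>2 ^ s p\<close> and the denominator
  \<open>2 ^ (2 * s p * (i + 1))\<close> with \<open>i + 1 \<le> d p\<close>; together this is the
  exponent built into \<open>N p\<close>.\<close>

lemma profile_lower_inside:
  assumes "i < d p"
  shows "1 / 2 ^ (s p * (2 * d p + 1)) \<le> norm (profile p i)"
proof -
  have le: "s p + 2 * (s p * (i + 1)) \<le> s p * (2 * d p + 1)"
    using assms mult_le_mono2[of "2 * (i + 1) + 1" "2 * d p + 1" "s p"] by (simp add: algebra_simps)
  have "1 / (2::real) ^ (s p * (2 * d p + 1)) \<le> 1 / 2 ^ (s p + 2 * (s p * (i + 1)))"
    using power_increasing[OF le, of "2::real"] by (intro divide_left_mono) auto
  also have "\<dots> = (1 / 2 ^ s p) / 4 ^ (s p * (i + 1))"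
    by (simp only: power_add[of _ "s p"] power_mult[of _ 2]) simp
  also have "\<dots> \<le> norm (a p i) / 4 ^ (s p * (i + 1))"
    by (intro divide_right_mono a_lower assms) simp
  also have "\<dots> = norm (profile p i)"
    using assms by (simp add: profile_def norm_divide norm_power norm_mult power_add)
  finally show ?thesis .
qed

lemma profile_lower: "1 / 2 ^ N p \<le> norm (profile p i)"
proof (cases "i < d p")
  case True
  have "1 / 2 ^ N p \<le> 1 / (2::real) ^ (s p * (2 * d p + 1))"
    by (intro divide_left_mono power_increasing) (auto simp: N_eq)
  then show ?thesis using profile_lower_inside[OF True] by linarith
next
  case False
  then show ?thesis by (simp add: profile_def norm_divide norm_power divide_right_mono)
qed

lemma profile_start: "norm (profile p 0) \<le> 1"
proof (cases "0 < d p")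
  case True
  have "norm (a p 0) \<le> 2 ^ s p" by (rule a_upper[OF True])
  also have "(2::real) ^ s p \<le> 4 ^ s p" by (intro power_mono) auto
  finally show ?thesis
    using True by (simp add: profile_def norm_divide norm_power)
next
  case False
  then show ?thesis by (simp add: profile_def norm_divide norm_power)
qed

lemma profile_last: "norm (profile p (N p - 1)) = 1 / 2"
proof -
  have "2 ^ (N p - 1) / 2 ^ N p = (1 / 2 :: real)" by (simp add: N_eq)
  moreover have "\<not> N p - 1 < d p" using d_less_N[of p] by simp
  ultimately show ?thesis by (simp add: profile_def norm_divide norm_power)
qed

text \<open>Only growth has to be controlled, as weights may be arbitrarily small. On the word the
  factor \<open>4 ^ s p\<close> outweighs the ratio of two letters; at its end the second branch
  starts below every value on the word; after that the profile doubles.\<close>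

lemma profile_step: "norm (profile p (Suc i)) \<le> 2 * norm (profile p i)"
proof -
  consider "Suc i < d p" | "Suc i = d p" | "d p \<le> i" by linarith
  then show ?thesis
  proof cases
    case 1
    have "norm (profile p (Suc i)) = norm (a p (Suc i)) / 4 ^ s p / 4 ^ (s p * (i + 1))"
      using 1 by (simp add: profile_def norm_divide norm_power norm_mult power_add algebra_simps)
    also have "\<dots> \<le> 2 ^ s p / 4 ^ s p / 4 ^ (s p * (i + 1))"
      by (intro divide_right_mono a_upper 1) auto
    also have "2 ^ s p / 4 ^ s p = (1 / 2 ^ s p :: real)"
      by (simp add: power_divide[symmetric] power_one_over)
    also have "1 / 2 ^ s p / 4 ^ (s p * (i + 1)) \<le> norm (a p i) / 4 ^ (s p * (i + 1))"
      using 1 by (intro divide_right_mono a_lower) auto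
    also have "\<dots> = norm (profile p i)"
      using 1 by (simp add: profile_def norm_divide norm_power norm_mult power_add)
    also have "\<dots> \<le> 2 * norm (profile p i)" by simp
    finally show ?thesis .
  next
    case 2
    have "norm (profile p (Suc i)) = 2 ^ d p / 2 ^ N p"
      using 2 by (simp add: profile_def norm_divide norm_power)
    also have "\<dots> \<le> 1 / 2 ^ (s p * (2 * d p + 1))"
      by (simp add: N_eq power_add field_simps)
    also have "\<dots> \<le> norm (profile p i)"
      using 2 by (intro profile_lower_inside) simp
    also have "\<dots> \<le> 2 * norm (profile p i)" by simp
    finally show ?thesis .
  next
    case 3
    then show ?thesis by (simp add: profile_def norm_divide norm_power norm_mult)
  qed
qed

definition weight_prod :: "nat \<Rightarrow> 'k"
  where "weight_prod k = 8 ^ k * fill 1 profile k"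

text \<open>A profile loses at most the factor \<open>2 ^ N p\<close>, and
  \<open>N p \<le> k\<close> within a block of \<open>E p\<close>.\<close>

lemma norm_weight_prod: "4 ^ k \<le> norm (weight_prod k)"
proof (cases "\<exists>p n i. in_block k p n i")
  case True
  then obtain p n i where b: "in_block k p n i" by blast
  then have "N p \<le> k" using E_ge unfolding in_block_def by fastforce
  have "(4::real) ^ k = 8 ^ k * (1 / 2 ^ k)"
    by (simp add: power_divide[symmetric])
  also have "\<dots> \<le> 8 ^ k * (1 / 2 ^ N p)"
    using \<open>N p \<le> k\<close> by (intro mult_left_mono divide_left_mono power_increasing) auto
  also have "\<dots> \<le> 8 ^ k * norm (profile p i)"
    by (intro mult_left_mono profile_lower) auto
  also have "\<dots> = norm (weight_prod k)"
    by (simp add: weight_prod_def fill_in[OF b] norm_mult norm_power)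
  finally show ?thesis .
next
  case False
  then have "fill 1 profile k = 1" by (intro fill_out) auto
  then show ?thesis by (simp add: weight_prod_def norm_mult norm_power power_mono)
qed

lemma weight_prod_nonzero: "weight_prod k \<noteq> 0"
proof
  assume "weight_prod k = 0"
  then have "(4::real) ^ k \<le> 0" using norm_weight_prod[of k] by simp
  moreover have "0 < (4::real) ^ k" by simp
  ultimately show False by linarith
qed

text \<open>Within one block this is \<open>profile_step\<close>. Otherwise \<open>Suc k\<close>
  starts a block or lies outside all blocks, with value at most 1 in norm, while \<open>k\<close>
  ends a block or lies outside, with value at least 1/2.\<close>

lemma fill_profile_step: "norm (fill 1 profile (Suc k)) \<le> 2 * norm (fill 1 profile k)"
proof (cases "\<exists>q m j. in_block (Suc k) q m (Suc j)")
  case True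
  then obtain q m j where b: "in_block (Suc k) q m (Suc j)" by blast
  then have "in_block k q m j" by (simp add: in_block_def)
  then show ?thesis using profile_step[of q j] by (simp add: fill_in[OF b] fill_in)
next
  case False
  have "norm (fill 1 profile (Suc k)) \<le> 1"
  proof (cases "\<exists>q m j. in_block (Suc k) q m j")
    case True
    then obtain q m j where b: "in_block (Suc k) q m j" by blast
    with False have "j = 0" by (cases j) auto
    then show ?thesis using profile_start[of q] by (simp add: fill_in[OF b])
  next
    case False
    then have "fill 1 profile (Suc k) = 1" by (intro fill_out) auto
    then show ?thesis by simp
  qed
  moreover have "1 / 2 \<le> norm (fill 1 profile k)"
  proof (cases "\<exists>p n i. in_block k p n i")
    case True
    then obtain p n i where b: "in_block k p n i" by blast
    \<comment> \<open>Otherwise \<open>Suc k\<close> would lie in the same block at the positive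
      position \<open>Suc i\<close>.\<close>
    have "\<not> Suc i < N p"
      using b False unfolding in_block_def by (metis add_Suc_right)
    with b have "i = N p - 1" by (auto simp: in_block_def)
    then show ?thesis using profile_last[of p] by (simp add: fill_in[OF b])
  next
    case False
    then have "fill 1 profile k = 1" by (intro fill_out) auto
    then show ?thesis by simp
  qed
  ultimately show ?thesis by linarith
qed

definition weight :: "nat \<Rightarrow> 'k"
  where "weight k = weight_prod k / weight_prod (k - 1)"

lemma weight_sequence_weight: "weight_sequence weight"
proof -
  \<comment> \<open>The factor 8 comes from \<open>8 ^ k\<close>, the factor 2 from
    \<open>fill_profile_step\<close>.\<close>
  have "norm (weight k) \<le> 16" if k: "k \<ge> 1" for k
  proof -
    obtain l where l: "k = Suc l" using k by (cases k) auto
    have "norm (weight_prod (Suc l)) \<le> 16 * norm (weight_prod l)"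
      using fill_profile_step[of l] by (simp add: weight_prod_def norm_mult norm_power)
    then show ?thesis
      using weight_prod_nonzero[of l] by (simp add: l weight_def norm_divide divide_le_eq)
  qed
  then show ?thesis
    unfolding weight_sequence_def bounded_iff using weight_prod_nonzero
    by (auto simp: weight_def)
qed

text \<open>The powers of 8 and of 4 cancel between the two factors, which is why a seed independent
  of \<open>a\<close> can reproduce any admissible word.\<close>

lemma weight_prod_seed_in:
  assumes "in_block k p n i" "i < d p"
  shows "weight_prod k * seed k = a p i"
  using assms by (simp add: weight_prod_def seed_def fill_in profile_def)

lemma weight_prod_seed_out:
  assumes "\<And>p n i. in_block k p n i \<Longrightarrow> \<not> i < d p"
  shows "weight_prod k * seed k = 0"
proof (cases "\<exists>p n i. in_block k p n i")
  case True
  then show ?thesis using assms by (auto simp: seed_def fill_in)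
next
  case False
  then show ?thesis by (simp add: seed_def fill_out)
qed

section \<open>Approximation of the targets along the orbit\<close>

lift_definition target :: "nat \<Rightarrow> 'k ell1"
  is "\<lambda>p k. if k < d p then a p k / weight_prod k else 0"
  by (rule summable_finite[of "{..<d _}"]) auto

text \<open>For \<open>k < N p\<close> the coordinates agree exactly. Letters of other words appear
  only at \<open>k \<ge> N p + N q\<close>, where they are at most
  \<open>2 ^ N q \<le> 2 ^ k / 2 ^ N p\<close> and are divided by a product of norm at least
  \<open>4 ^ k\<close>.\<close>

lemma shift_seed_near_target:
  assumes n: "n \<in> E p"
  shows "norm ((weighted_shift weight ^^ n) seed_vector - target p) \<le> 2 * (1 / 2 ^ N p)"
proof (rule norm_ell1_le_geometric)
  fix k
  define v where "v = weight_prod (n + k) * seed (n + k)"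
  have c: "coord ((weighted_shift weight ^^ n) seed_vector - target p) k
      = (v - (if k < d p then a p k else 0)) / weight_prod k"
    by (simp add: minus_ell1.rep_eq target.rep_eq coord_seed_vector v_def diff_divide_distrib
        coord_weighted_shift_funpow[OF weight_sequence_weight weight_prod_nonzero] weight_def)
  show "norm (coord ((weighted_shift weight ^^ n) seed_vector - target p) k)
      \<le> 1 / 2 ^ N p * (1/2) ^ k"
  proof (cases "k < N p \<or> v = 0")
    case True
    have "v = (if k < d p then a p k else 0)"
    proof (cases "k < N p")
      case True
      then have b: "in_block (n + k) p n k" using n by (simp add: in_block_def)
      show ?thesis
      proof (cases "k < d p")
        case True
        then show ?thesis using weight_prod_seed_in[OF b] by (simp add: v_def)
      next
        case False
        then have "v = 0"
          unfolding v_def by (intro weight_prod_seed_out) (metis b in_block_unique)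
        then show ?thesis using False by simp
      qed
    next
      case False
      then show ?thesis using True d_less_N[of p] by simp
    qed
    then show ?thesis by (simp add: c)
  next
    case False
    then obtain q m j where b: "in_block (n + k) q m j" "j < d q"
      using weight_prod_seed_out v_def by blast
    have v: "v = a q j" unfolding v_def by (rule weight_prod_seed_in[OF b])
    \<comment> \<open>The letter belongs to a later block: a block starting before \<open>n\<close>
      ends before \<open>n\<close>, and \<open>m = n\<close> would give
      \<open>k < d p\<close>.\<close>
    have "n + N p + N q \<le> m"
    proof (cases n m rule: linorder_cases)
      case less
      then show ?thesis using E_separated n b by (auto simp: in_block_def)
    next
      case equal
      then show ?thesis using E_disjoint[of n p q] n b False by (auto simp: in_block_def)
    next
      case greater
      then show ?thesis using E_separated[of m q n p] n b by (auto simp: in_block_def)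
    qed
    then have k: "N p + N q \<le> k" using b by (simp add: in_block_def)
    have "s q \<le> N q" by (simp add: N_eq)
    have "norm v \<le> 2 ^ s q" unfolding v by (rule a_upper[OF b(2)])
    also have "\<dots> \<le> 2 ^ N q" using \<open>s q \<le> N q\<close> by (intro power_increasing) auto
    also have "\<dots> = 2 ^ (N p + N q) / 2 ^ N p" by (simp add: power_add)
    also have "\<dots> \<le> 2 ^ k / 2 ^ N p"
      using k by (intro divide_right_mono power_increasing) auto
    finally have v_le: "norm v \<le> 2 ^ k / 2 ^ N p" .
    have "norm (v / weight_prod k) = norm v / norm (weight_prod k)" by (rule norm_divide)
    also have "\<dots> \<le> (2 ^ k / 2 ^ N p) / 4 ^ k"
      using v_le norm_weight_prod[of k] by (intro frac_le) auto
    also have "\<dots> = 1 / 2 ^ N p * (2 ^ k / 4 ^ k)" by simp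
    also have "(2::real) ^ k / 4 ^ k = (1/2) ^ k" by (simp add: power_divide[symmetric])
    finally show ?thesis using False d_less_N[of p] by (simp add: c)
  qed
qed

text \<open>The coordinates on the word contribute at most the geometric sum \<open>2 * r\<close>;
  beyond the word the target vanishes and only the tail of \<open>u\<close> remains.\<close>

lemma norm_target_diff_less:
  assumes near: "\<And>k. k < d p \<Longrightarrow>
      norm (a p k - weight_prod k * coord u k) \<le> norm (weight_prod k) * (r * (1/2) ^ k)"
    and tail: "(\<Sum>k. norm (coord u (k + d p))) < r"
    and "0 \<le> r"
  shows "norm (target p - u) < 3 * r"
proof -
  have sums: "summable (\<lambda>k. norm (coord (target p - u) k))" by simp
  have "norm (target p - u) = (\<Sum>k. norm (coord (target p - u) (k + d p)))
      + (\<Sum>k<d p. norm (coord (target p - u) k))"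
    unfolding norm_ell1_eq by (rule suminf_split_initial_segment[OF sums])
  also have "(\<Sum>k. norm (coord (target p - u) (k + d p))) = (\<Sum>k. norm (coord u (k + d p)))"
    by (simp add: minus_ell1.rep_eq target.rep_eq)
  also have "(\<Sum>k<d p. norm (coord (target p - u) k)) \<le> (\<Sum>k<d p. r * (1/2) ^ k)"
  proof (rule sum_mono)
    fix k assume k: "k \<in> {..<d p}"
    have "coord (target p - u) k = (a p k - weight_prod k * coord u k) / weight_prod k"
      using k weight_prod_nonzero[of k]
      by (simp add: minus_ell1.rep_eq target.rep_eq diff_divide_distrib)
    then show "norm (coord (target p - u) k) \<le> r * (1/2) ^ k"
      using near[of k] k weight_prod_nonzero[of k]
      by (simp add: norm_divide divide_le_eq mult.commute)
  qed
  also have "(\<Sum>k<d p. r * (1/2) ^ k) = r * (\<Sum>k<d p. (1/2) ^ k)"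
    by (simp add: sum_distrib_left)
  also have "\<dots> \<le> r * 2"
    using \<open>0 \<le> r\<close> by (intro mult_left_mono) (simp_all add: sum_gp_strict)
  finally show ?thesis using tail by linarith
qed

end

section \<open>Density of the targets\<close>

lemma (in separated_blocks) two_block_weights_dense:
  fixes a b :: "nat \<Rightarrow> nat \<Rightarrow> 'k::real_normed_field" and u v :: "'k ell1"
  assumes A: "block_weights d s N E a" and B: "block_weights d s N E b"
    and dense: "\<And>m \<alpha> \<beta> \<eta> \<eta>'. (\<And>j. 0 < \<eta> j \<and> 0 < \<eta>' j) \<Longrightarrow>
      \<exists>p. d p = m \<and> (\<forall>j<m. norm (a p j - \<alpha> j) < \<eta> j \<and> norm (b p j - \<beta> j) < \<eta>' j)"
    and "0 < e"
  shows "\<exists>p. \<forall>n\<in>E p.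
    norm ((weighted_shift (block_weights.weight d s N E a) ^^ n) seed_vector - u) < e \<and>
    norm ((weighted_shift (block_weights.weight d s N E b) ^^ n) seed_vector - v) < e"
proof -
  interpret A: block_weights d s N E a by (rule A)
  interpret B: block_weights d s N E b by (rule B)
  \<comment> \<open>The target is within \<open>3 * r\<close> of the given vector, and the iterate
    within \<open>2 * r\<close> of the target.\<close>
  define r where "r = e / 5"
  have "0 < r" using \<open>0 < e\<close> by (simp add: r_def)
  obtain m1 where m1: "\<And>m. m \<ge> m1 \<Longrightarrow> norm (\<Sum>k. norm (coord u (k + m))) < r"
    using suminf_exist_split[OF \<open>0 < r\<close> summable_norm_coord[of u]] by blast
  obtain m2 where m2: "\<And>m. m \<ge> m2 \<Longrightarrow> norm (\<Sum>k. norm (coord v (k + m))) < r"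
    using suminf_exist_split[OF \<open>0 < r\<close> summable_norm_coord[of v]] by blast
  obtain m3 where m3: "(1/2::real) ^ m3 < r"
    using real_arch_pow_inv[OF \<open>0 < r\<close>] by force
  \<comment> \<open>Word length \<open>m\<close> makes both tails small; since \<open>N p\<close>
    exceeds \<open>d p = m\<close>, it also makes the error \<open>2 * (1 / 2 ^ N p)\<close>
    small.\<close>
  define m where "m = max m1 (max m2 m3)"
  obtain p where p: "d p = m"
    "\<And>j. j < m \<Longrightarrow> norm (a p j - A.weight_prod j * coord u j) < norm (A.weight_prod j) * (r * (1/2) ^ j)"
    "\<And>j. j < m \<Longrightarrow> norm (b p j - B.weight_prod j * coord v j) < norm (B.weight_prod j) * (r * (1/2) ^ j)"
    using dense[of "\<lambda>j. norm (A.weight_prod j) * (r * (1/2) ^ j)"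
        "\<lambda>j. norm (B.weight_prod j) * (r * (1/2) ^ j)" m
        "\<lambda>j. A.weight_prod j * coord u j" "\<lambda>j. B.weight_prod j * coord v j"]
      \<open>0 < r\<close> A.weight_prod_nonzero B.weight_prod_nonzero by auto
  have u: "norm (A.target p - u) < 3 * r"
  proof (rule A.norm_target_diff_less)
    have "norm (\<Sum>k. norm (coord u (k + m))) < r" by (rule m1) (simp add: m_def)
    then show "(\<Sum>k. norm (coord u (k + d p))) < r" by (simp add: p(1))
  qed (use p \<open>0 < r\<close> in \<open>auto intro: less_imp_le\<close>)
  have v: "norm (B.target p - v) < 3 * r"
  proof (rule B.norm_target_diff_less)
    have "norm (\<Sum>k. norm (coord v (k + m))) < r" by (rule m2) (simp add: m_def)
    then show "(\<Sum>k. norm (coord v (k + d p))) < r" by (simp add: p(1))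
  qed (use p \<open>0 < r\<close> in \<open>auto intro: less_imp_le\<close>)
  have "(1/2::real) ^ N p \<le> (1/2) ^ m3"
    using d_less_N[of p] p(1) by (intro power_decreasing) (auto simp: m_def)
  then have small: "2 * (1 / 2 ^ N p) < 2 * r"
    using m3 by (simp add: power_one_over)
  show ?thesis
  proof (intro exI[of _ p] ballI conjI)
    fix n assume n: "n \<in> E p"
    show "norm ((weighted_shift A.weight ^^ n) seed_vector - u) < e"
      using norm_diff_triangle_less[OF le_less_trans[OF A.shift_seed_near_target[OF n] small] u]
      by (simp add: r_def)
    show "norm ((weighted_shift B.weight ^^ n) seed_vector - v) < e"
      using norm_diff_triangle_less[OF le_less_trans[OF B.shift_seed_near_target[OF n] small] v]
      by (simp add: r_def)
  qed
qed

lemma open_vec2_norm: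
  fixes U :: "('a::real_normed_vector ^ 2) set"
  assumes "open U" "y \<in> U"
  obtains e where "0 < e"
    "\<And>z. norm (z $ 1 - y $ 1) < e \<Longrightarrow> norm (z $ 2 - y $ 2) < e \<Longrightarrow> z \<in> U"
proof -
  obtain A where A: "\<And>i. open (A i) \<and> y $ i \<in> A i" "\<And>z. (\<forall>i. z $ i \<in> A i) \<Longrightarrow> z \<in> U"
    using assms unfolding open_vec_def by metis
  obtain e1 where e1: "0 < e1" "ball (y $ 1) e1 \<subseteq> A 1"
    using A(1) open_contains_ball by blast
  obtain e2 where e2: "0 < e2" "ball (y $ 2) e2 \<subseteq> A 2"
    using A(1) open_contains_ball by blast
  show ?thesis
  proof (rule that[of "min e1 e2"])
    fix z :: "'a ^ 2"
    assume "norm (z $ 1 - y $ 1) < min e1 e2" "norm (z $ 2 - y $ 2) < min e1 e2"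
    then have "z $ 1 \<in> ball (y $ 1) e1" "z $ 2 \<in> ball (y $ 2) e2"
      by (auto simp: dist_norm norm_minus_commute)
    then show "z \<in> U"
      using e1(2) e2(2) by (intro A(2)) (auto simp: forall_2)
  qed (use e1 e2 in auto)
qed

theorem theorem3p1:
  "\<exists>w w' :: nat \<Rightarrow> 'k::{real_normed_field, euclidean_space}.
     weight_sequence w \<and> weight_sequence w' \<and>
     disjointly_frequently_hypercyclic
       (\<lambda>i::2. if i = 1 then weighted_shift w else weighted_shift w')"
proof -
  obtain d :: "nat \<Rightarrow> nat" and a b :: "nat \<Rightarrow> nat \<Rightarrow> 'k" where
    nz: "\<And>p j. j < d p \<Longrightarrow> a p j \<noteq> 0 \<and> b p j \<noteq> 0" and
    dense: "\<And>m \<alpha> \<beta> \<eta> \<eta>'. (\<And>j. 0 < \<eta> j \<and> 0 < \<eta>' j) \<Longrightarrow>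
      \<exists>p. d p = m \<and> (\<forall>j<m. norm (a p j - \<alpha> j) < \<eta> j \<and> norm (b p j - \<beta> j) < \<eta>' j)"
    using dense_enumeration by blast
  \<comment> \<open>For each \<open>p\<close> there are finitely many letters, all nonzero, so the
    sum of their norms and inverse norms bounds both at once.\<close>
  have "\<exists>s. \<forall>j<d p. \<forall>z\<in>{a p j, b p j}. norm z \<le> 2 ^ s \<and> 1 / 2 ^ s \<le> norm z" for p
  proof -
    define Z where "Z = (\<Union>j<d p. {a p j, b p j})"
    define M where "M = (\<Sum>z\<in>Z. norm z + 1 / norm z)"
    have "finite Z" by (simp add: Z_def)
    obtain s where s: "M < 2 ^ s"
      using real_arch_pow[of 2 M] by auto
    have "norm z \<le> 2 ^ s \<and> 1 / 2 ^ s \<le> norm z" if z: "z \<in> Z" for z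
    proof -
      have "0 < norm z" using z nz by (auto simp: Z_def)
      have "norm z + 1 / norm z \<le> M"
        unfolding M_def by (rule member_le_sum[OF z _ \<open>finite Z\<close>]) auto
      then have "norm z \<le> 2 ^ s" "1 / norm z \<le> 2 ^ s"
        using s \<open>0 < norm z\<close> by (smt (verit) divide_pos_pos)+
      then show ?thesis
        using \<open>0 < norm z\<close> by (simp add: field_simps)
    qed
    then show ?thesis by (intro exI[of _ s]) (auto simp: Z_def)
  qed
  then obtain s where s:
    "\<And>p j z. j < d p \<Longrightarrow> z \<in> {a p j, b p j} \<Longrightarrow> norm z \<le> 2 ^ s p \<and> 1 / 2 ^ s p \<le> norm z"
    by metis
  define N where "N p = Suc (d p + s p * (2 * d p + 1))" for p
  obtain E where E: "\<And>p. lower_density (E p) > 0"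
    "\<And>p n. n \<in> E p \<Longrightarrow> N p \<le> n"
    "\<And>p q n. n \<in> E p \<Longrightarrow> n \<in> E q \<Longrightarrow> p = q"
    "\<And>p q n m. n \<in> E p \<Longrightarrow> m \<in> E q \<Longrightarrow> n < m \<Longrightarrow> n + N p + N q \<le> m"
    using separated_sets[of N] by (auto simp: N_def)
  interpret separated_blocks d s N E
    by unfold_locales (fact N_def E)+
  \<comment> \<open>Both weights live on the same blocks with the same \<open>s\<close>, hence share
    \<open>seed_vector\<close>.\<close>
  interpret A: block_weights d s N E a
    by unfold_locales (use s in auto)
  interpret B: block_weights d s N E b
    by unfold_locales (use s in auto)
  define T where "T = (\<lambda>i::2. if i = 1 then weighted_shift A.weight else weighted_shift B.weight)"
  have "disjointly_frequently_hypercyclic T"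
    unfolding disjointly_frequently_hypercyclic_def
  proof (intro conjI allI exI[of _ seed_vector] impI)
    fix i
    have "bounded_linear (T i)"
      unfolding T_def
      by (simp add: bounded_linear_weighted_shift A.weight_sequence_weight B.weight_sequence_weight)
    then show "linear (T i)" "continuous_on UNIV (T i)"
      by (simp_all add: bounded_linear.linear linear_continuous_on)
  next
    fix U :: "('k ell1 ^ 2) set"
    assume "open U \<and> U \<noteq> {}"
    then obtain y where "open U" "y \<in> U" by blast
    obtain e where e: "0 < e"
      "\<And>z. norm (z $ 1 - y $ 1) < e \<Longrightarrow> norm (z $ 2 - y $ 2) < e \<Longrightarrow> z \<in> U"
      using open_vec2_norm[OF \<open>open U\<close> \<open>y \<in> U\<close>] by blast
    obtain p where "\<And>n. n \<in> E p \<Longrightarrow>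
        norm ((weighted_shift A.weight ^^ n) seed_vector - y $ 1) < e \<and>
        norm ((weighted_shift B.weight ^^ n) seed_vector - y $ 2) < e"
      using two_block_weights_dense[OF A.block_weights_axioms B.block_weights_axioms dense e(1)]
      by blast
    then have "E p \<subseteq> {n. (\<chi> i. (T i ^^ n) seed_vector) \<in> U}"
      by (auto simp: T_def intro!: e(2))
    then show "lower_density {n. (\<chi> i. (T i ^^ n) seed_vector) \<in> U} > 0"
      using E(1)[of p] lower_density_mono less_le_trans by blast
  qed
  then show ?thesis
    unfolding T_def using A.weight_sequence_weight B.weight_sequence_weight by blast
qed

end
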